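(* Let $I$ be a nonempty, finite set. For each $i \in I$, let $\succ_i$ be a strict preference relation on $I$. Then there is a nonempty subset $Y \subseteq I$ satisfying both of the following: (a) Optimality: $\{\mathrm{best}_i(Y) : i \in Y\} = Y$. (b) No Bullying: there is no $x \in I$ such that $\mathrm{best}_i(Y) \succ_i x$ for all $i \in Y$.
   Context: A strict preference relation $\succ$ on a set $X$ is a binary relation on $X$ that is total (for all distinct $x, y \in X$, $x \succ y$ or $y \succ x$), irreflexive (there is no $x$ with $x \succ x$), and transitive (if $x \succ y$ and $y \succ z$ then $x \succ z$). Here $x \succ_i y$ is read as "$i$ strictly prefers $x$ to $y$". For a nonempty subset $Y$ of the finite set $I$, $\mathrm{best}_i(Y)$ denotes the most preferred element of $Y$ according to $\succ_i$, i.e., the unique $y \in Y$ with $y \succ_i y'$ for all $y' \in Y \setminus \{y\}$. *)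

theory Defs
  imports Main
begin

(* Only the restriction of the predicate to X is constrained; its values outside X are junk. *)
definition strict_preference_on :: "'a set \<Rightarrow> ('a \<Rightarrow> 'a \<Rightarrow> bool) \<Rightarrow> bool" where
  "strict_preference_on X R \<longleftrightarrow> totalp_on X R \<and> irreflp_on X R \<and> transp_on X R"

(* Well defined when R is a strict preference on a superset of Y and Y is finite and nonempty. *)
definition best :: "('a \<Rightarrow> 'a \<Rightarrow> bool) \<Rightarrow> 'a set \<Rightarrow> 'a" where
  "best R Y = (THE y. y \<in> Y \<and> (\<forall>y' \<in> Y - {y}. R y y'))"

end

theory Submission
  imports Defs
begin

text \<open>
  Read the two roles of \<open>I\<close> separately: a set \<open>S\<close> of agents and a set \<open>T\<close> of alternatives form an
  unbullied pair if no alternative is beaten, for every agent of \<open>S\<close>, by some member of \<open>T\<close>. Applied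
  to the members of \<open>T\<close> themselves, this says that each of them is the favourite in \<open>T\<close> of some
  agent of \<open>S\<close>. So a nonempty \<open>Y\<close> has both required properties as soon as the pair \<open>Y\<close>, \<open>Y\<close> is
  unbullied, and the task is to find an unbullied pair on the diagonal.

  Such a pair exists by a parity argument in the style of Sperner's and Scarf's lemmas. Unbullied
  pairs behave like the cells of a triangulation: being unbullied survives adding an agent and
  removing an alternative, and the pairs with as many agents as alternatives (rooms) are glued
  together along the pairs with one agent more (doors). The geometric heart of the matter is lemma
  \<open>door_between_two_rooms\<close>: a door with at least one alternative leads to exactly two rooms. The door
  with agent \<open>j\<close> and no alternative leads to exactly one, the room that consists of \<open>j\<close> and the
  alternative \<open>j\<close> likes least.

  Fix \<open>j\<close> and keep only the doors of the form \<open>A\<close>, \<open>A - {j}\<close> with \<open>j \<in> A\<close>. An off-diagonal room with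
  such a door is of the form \<open>A\<close>, \<open>insert i (A - {j})\<close> with \<open>j \<in> A\<close> and \<open>i \<notin> A\<close>, and it has exactly
  two such doors, given by \<open>A\<close> and \<open>insert i A\<close>. If there were no diagonal room, then the doors and
  rooms would form a finite graph in which every vertex has degree two, apart from the single vertex
  \<open>{j}\<close> of degree one. The sum of the degrees of a graph is even, so this is impossible.
\<close>

section \<open>Unbullied pairs\<close>

locale preference_profile =
  fixes I :: "'a set" and pref :: "'a \<Rightarrow> 'a \<Rightarrow> 'a \<Rightarrow> bool"
  assumes finite_I: "finite I"
    and strict: "i \<in> I \<Longrightarrow> strict_preference_on I (pref i)"
begin

text \<open>
  Saying that some member of \<open>T\<close> beats \<open>x\<close>, instead of that the best one does, makes the notion
  meaningful for empty \<open>T\<close> and makes its monotonicity evident.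
\<close>

definition unbullied :: "'a set \<Rightarrow> 'a set \<Rightarrow> bool" where
  "unbullied S T \<longleftrightarrow> (\<forall>x\<in>I. \<exists>i\<in>S. \<forall>t\<in>T. \<not> pref i t x)"

lemma pref_total: "i \<in> I \<Longrightarrow> x \<in> I \<Longrightarrow> y \<in> I \<Longrightarrow> x \<noteq> y \<Longrightarrow> pref i x y \<or> pref i y x"
  using strict[of i] by (auto simp: strict_preference_on_def totalp_on_def)

lemma pref_irrefl: "i \<in> I \<Longrightarrow> x \<in> I \<Longrightarrow> \<not> pref i x x"
  using strict[of i] by (auto simp: strict_preference_on_def irreflp_on_def)

lemma pref_trans:
  "i \<in> I \<Longrightarrow> x \<in> I \<Longrightarrow> y \<in> I \<Longrightarrow> z \<in> I \<Longrightarrow> pref i x y \<Longrightarrow> pref i y z \<Longrightarrow> pref i x z"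
  using strict[of i] unfolding strict_preference_on_def transp_on_def by blast

lemma unbullied_mono: "unbullied S T \<Longrightarrow> S \<subseteq> S' \<Longrightarrow> T' \<subseteq> T \<Longrightarrow> unbullied S' T'"
  unfolding unbullied_def by blast

lemma ex_best:
  assumes i: "i \<in> I" and T: "T \<subseteq> I" "T \<noteq> {}"
  shows "\<exists>y\<in>T. \<forall>y'\<in>T - {y}. pref i y y'"
proof -
  have "finite T" using T(1) finite_I by (rule finite_subset)
  then show ?thesis using T(2,1)
  proof (induction T rule: finite_ne_induct)
    case (singleton x)
    then show ?case by simp
  next
    case (insert x F)
    then obtain y where y: "y \<in> F" "\<forall>y'\<in>F - {y}. pref i y y'" by auto
    have "x \<in> I" "y \<in> I" "x \<noteq> y" using insert y by auto
    then consider "pref i x y" | "pref i y x" using pref_total[OF i] by blast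
    then show ?case
    proof cases
      case 1
      have "pref i x y'" if "y' \<in> F" for y'
      proof (cases "y' = y")
        case False
        then show ?thesis using pref_trans[OF i, of x y y'] 1 y that insert.prems by auto
      qed (use 1 in simp)
      then show ?thesis by auto
    next
      case 2
      then show ?thesis using y by auto
    qed
  qed
qed

lemma best_mem_and_beats:
  assumes i: "i \<in> I" and T: "T \<subseteq> I" "T \<noteq> {}"
  shows "best (pref i) T \<in> T" "\<And>t. t \<in> T \<Longrightarrow> t \<noteq> best (pref i) T \<Longrightarrow> pref i (best (pref i) T) t"
proof -
  have unique: "y = z" if "y \<in> T" "z \<in> T" "\<forall>t\<in>T - {y}. pref i y t" "\<forall>t\<in>T - {z}. pref i z t" for y z
    using that pref_trans[OF i, of y z y] pref_irrefl[OF i, of y] T(1) by blast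
  obtain y where y: "y \<in> T" "\<forall>t\<in>T - {y}. pref i y t" using ex_best[OF i T] by blast
  have "best (pref i) T = y"
    unfolding best_def by (rule the_equality) (use y unique in auto)
  then show "best (pref i) T \<in> T"
    and "\<And>t. t \<in> T \<Longrightarrow> t \<noteq> best (pref i) T \<Longrightarrow> pref i (best (pref i) T) t"
    using y by auto
qed

lemma not_beaten_iff_best:
  assumes i: "i \<in> I" and T: "T \<subseteq> I" and t: "t \<in> T"
  shows "(\<forall>t'\<in>T. \<not> pref i t' t) \<longleftrightarrow> best (pref i) T = t"
proof
  have "T \<noteq> {}" using t by blast
  note b = best_mem_and_beats[OF i T this]
  show "best (pref i) T = t" if "\<forall>t'\<in>T. \<not> pref i t' t"
    using that b t by blast
  show "\<forall>t'\<in>T. \<not> pref i t' t" if "best (pref i) T = t"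
    using that b(2) pref_trans[OF i, of t _ t] pref_irrefl[OF i, of t] T t by blast
qed

lemma unbullied_imp_best_image:
  assumes "S \<subseteq> I" "T \<subseteq> I" "T \<noteq> {}" "unbullied S T"
  shows "(\<lambda>i. best (pref i) T) ` S = T"
proof
  show "(\<lambda>i. best (pref i) T) ` S \<subseteq> T" using best_mem_and_beats(1) assms by blast
  show "T \<subseteq> (\<lambda>i. best (pref i) T) ` S"
  proof
    fix t assume t: "t \<in> T"
    then obtain i where "i \<in> S" "\<forall>t'\<in>T. \<not> pref i t' t"
      using assms unfolding unbullied_def by blast
    then show "t \<in> (\<lambda>i. best (pref i) T) ` S" using not_beaten_iff_best assms t by blast
  qed
qed

lemma ex1_worst:
  assumes i: "i \<in> I" and M: "M \<subseteq> I" "M \<noteq> {}"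
  shows "\<exists>x. {x \<in> M. \<forall>z\<in>M. \<not> pref i x z} = {x}"
proof -
  \<comment> \<open>The worst element is the best one for the reversed preferences.\<close>
  interpret rev: preference_profile I "\<lambda>i x y. pref i y x"
  proof
    show "strict_preference_on I (\<lambda>x y. pref i y x)" if "i \<in> I" for i
      using pref_total[OF that] pref_irrefl[OF that] pref_trans[OF that]
      unfolding strict_preference_on_def totalp_on_def irreflp_on_def transp_on_def by blast
  qed (rule finite_I)
  show ?thesis
    using rev.not_beaten_iff_best[OF i M(1)] rev.best_mem_and_beats(1)[OF i M] by blast
qed

section \<open>A door leads to two rooms\<close>

definition bullied_without :: "'a set \<Rightarrow> 'a set \<Rightarrow> 'a \<Rightarrow> 'a set" where
  "bullied_without S T p = {x \<in> I. \<forall>k\<in>S - {p}. \<exists>t\<in>T. pref k t x}"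

text \<open>
  Agent \<open>p\<close> gives exactly one way out of a door. If nobody is bullied after \<open>p\<close> leaves, the agent
  can be removed. Otherwise only \<open>p\<close> protects the alternatives in \<open>bullied_without S T p\<close>, so one of
  these can be added to \<open>T\<close> just in case \<open>p\<close> likes it least among them. The disjointness
  assumption says that the other agents still cover \<open>T\<close> by favourites.
\<close>

lemma one_room_per_agent:
  assumes S: "S \<subseteq> I" and T: "T \<subseteq> I" and p: "p \<in> S" and ST: "unbullied S T"
    and disj: "bullied_without S T p \<inter> T = {}"
  shows "card {x \<in> bullied_without S T p. unbullied S (insert x T)}
           + (if unbullied (S - {p}) T then 1 else 0) = 1"
proof -
  define M where "M = bullied_without S T p"
  have MI: "M \<subseteq> I" and pI: "p \<in> I" using S p by (auto simp: M_def bullied_without_def)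
  have empty_iff: "M = {} \<longleftrightarrow> unbullied (S - {p}) T"
    unfolding M_def bullied_without_def unbullied_def by blast
  have p_protects: "\<not> pref p t x" if "x \<in> M" "t \<in> T" for x t
    using ST that unfolding M_def bullied_without_def unbullied_def by blast
  have worst: "unbullied S (insert x T) \<longleftrightarrow> (\<forall>z\<in>M. \<not> pref p x z)" if x: "x \<in> M" for x
  proof
    assume "unbullied S (insert x T)"
    then show "\<forall>z\<in>M. \<not> pref p x z"
      unfolding M_def bullied_without_def unbullied_def by blast
  next
    assume *: "\<forall>z\<in>M. \<not> pref p x z"
    show "unbullied S (insert x T)" unfolding unbullied_def
    proof
      fix z assume z: "z \<in> I"
      show "\<exists>i\<in>S. \<forall>t\<in>insert x T. \<not> pref i t z"
      proof (cases "z \<in> M")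
        case True
        then show ?thesis using * p_protects p by blast
      next
        case False
        then obtain k where k: "k \<in> S - {p}" "\<forall>t\<in>T. \<not> pref k t z"
          using z unfolding M_def bullied_without_def by blast
        \<comment> \<open>Agent \<open>k\<close> prefers some \<open>t \<in> T\<close> to \<open>x\<close>, so \<open>x\<close> cannot beat what \<open>t\<close> does not beat.\<close>
        obtain t where t: "t \<in> T" "pref k t x"
          using x k unfolding M_def bullied_without_def by blast
        have "\<not> pref k x z"
          using pref_trans[of k t x z] k t z x MI S T by blast
        then show ?thesis using k by blast
      qed
    qed
  qed
  have set_eq: "{x \<in> M. unbullied S (insert x T)} = {x \<in> M. \<forall>z\<in>M. \<not> pref p x z}"
    using worst by blast
  show ?thesis
  proof (cases "M = {}")
    case True
    then show ?thesis using empty_iff by (simp add: M_def)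
  next
    case False
    then show ?thesis using empty_iff ex1_worst[OF pI MI False] set_eq by (auto simp: M_def)
  qed
qed

end

text \<open>
  A surjection onto a set with one element less identifies exactly one pair of points, and these are
  the only points whose removal keeps it surjective.
\<close>

lemma surj_card_Suc_collision:
  assumes fin: "finite S" and im: "f ` S = T" and card: "card S = Suc (card T)"
  obtains p q where "p \<in> S" "q \<in> S" "p \<noteq> q"
    "\<And>i. i \<in> S \<Longrightarrow> f ` (S - {i}) = T \<longleftrightarrow> i = p \<or> i = q"
proof -
  have "\<not> inj_on f S" using card_image[of f S] im card by auto
  then obtain p q where pq: "p \<in> S" "q \<in> S" "p \<noteq> q" "f p = f q"
    unfolding inj_on_def by blast
  have im_p: "f ` (S - {p}) = T" and im_q: "f ` (S - {q}) = T"
    using pq im by (auto simp: image_iff) (metis pq insert_Diff insert_iff)+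
  have inj_p: "inj_on f (S - {p})"
    using im_p fin pq card by (intro eq_card_imp_inj_on) auto
  have "i = p \<or> i = q" if i: "i \<in> S" "f ` (S - {i}) = T" for i
  proof (rule ccontr)
    assume ne: "\<not> (i = p \<or> i = q)"
    have "f i \<in> f ` (S - {i})" using i im by blast
    then obtain k where k: "k \<in> S" "k \<noteq> i" "f k = f i" by (metis DiffE imageE singletonI)
    show False
      using inj_p k i ne pq unfolding inj_on_def by (metis Diff_iff singletonD)
  qed
  then show thesis using that[of p q] pq im_p im_q by blast
qed

context preference_profile
begin

text \<open>
  In a door with at least one alternative, exactly two agents \<open>p\<close> and \<open>q\<close> share their favourite.
  Every room behind the door makes one agent superfluous for covering \<open>T\<close> by favourites: the removed
  agent, or the one whose new favourite is the added alternative. This agent has to be \<open>p\<close> or \<open>q\<close>,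
  and each of the two accounts for one room.
\<close>

lemma door_between_two_rooms:
  assumes S: "S \<subseteq> I" and T: "T \<subseteq> I" "T \<noteq> {}" and card: "card S = Suc (card T)"
    and ST: "unbullied S T"
  shows "card {x \<in> I - T. unbullied S (insert x T)} + card {i \<in> S. unbullied (S - {i}) T} = 2"
proof -
  define b where "b i = best (pref i) T" for i
  have finS: "finite S" using S finite_I by (rule finite_subset)
  have im: "b ` S = T"
    unfolding b_def by (rule unbullied_imp_best_image[OF S T ST])
  obtain p q where pq: "p \<in> S" "q \<in> S" "p \<noteq> q"
    and cover: "\<And>i. i \<in> S \<Longrightarrow> b ` (S - {i}) = T \<longleftrightarrow> i = p \<or> i = q"
    using surj_card_Suc_collision[OF finS im card] by blast
  have b_iff: "(\<forall>t'\<in>T. \<not> pref i t' t) \<longleftrightarrow> b i = t" if "i \<in> S" "t \<in> T" for i t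
    unfolding b_def using not_beaten_iff_best[OF _ T(1)] that S by blast
  let ?M = "bullied_without S T"
  let ?N = "\<lambda>p. {x \<in> ?M p. unbullied S (insert x T)}"
  have M_T: "?M k \<inter> T = {}" if "k = p \<or> k = q" for k
  proof -
    have "t \<notin> ?M k" if "t \<in> T" for t
    proof -
      have "t \<in> b ` (S - {k})" using cover[of k] \<open>k = p \<or> k = q\<close> pq that by blast
      then obtain i where "i \<in> S - {k}" "b i = t" by blast
      then show ?thesis using b_iff[of i t] that unfolding bullied_without_def by blast
    qed
    then show ?thesis by blast
  qed
  have M_disj: "?M p \<inter> ?M q = {}"
    using ST pq unfolding bullied_without_def unbullied_def by blast
  have up_pq: "x \<in> ?M p \<union> ?M q" if x: "x \<in> I - T" and ub: "unbullied S (insert x T)" for x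
  proof -
    obtain k where k: "k \<in> S" "\<forall>t\<in>T. \<not> pref k t x"
      using ub x unfolding unbullied_def by blast
    \<comment> \<open>An agent who ranks \<open>x\<close> above all of \<open>T\<close> does not serve as protector of any \<open>t \<in> T\<close>.\<close>
    have protector: "\<exists>i\<in>S. b i = t \<and> \<not> (\<forall>s\<in>T. \<not> pref i s x)" if t: "t \<in> T" for t
    proof -
      obtain i where i: "i \<in> S" "\<forall>t'\<in>insert x T. \<not> pref i t' t"
        using ub t T unfolding unbullied_def by blast
      then have "pref i t x" using pref_total[of i t x] x t T(1) S by blast
      then show ?thesis using i b_iff t by blast
    qed
    define K where "K = {i \<in> S. \<forall>s\<in>T. \<not> pref i s x}"
    have covers: "b ` (S - K) = T"
    proof
      show "b ` (S - K) \<subseteq> T" using im by blast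
      show "T \<subseteq> b ` (S - K)"
      proof
        fix t assume "t \<in> T"
        then obtain i where "i \<in> S" "b i = t" "\<not> (\<forall>s\<in>T. \<not> pref i s x)"
          using protector by blast
        then have "i \<in> S - K" unfolding K_def by blast
        then show "t \<in> b ` (S - K)" using \<open>b i = t\<close> by blast
      qed
    qed
    \<comment> \<open>Since \<open>S\<close> has only one agent to spare for covering \<open>T\<close>, only \<open>k\<close> ranks \<open>x\<close> on top.\<close>
    have "card T \<le> card (S - K)"
      using covers card_image_le[of "S - K" b] finS by auto
    moreover have "card (S - K) = card S - card K" "card K \<le> card S"
      using finS by (auto simp: K_def card_Diff_subset intro: card_mono)
    ultimately have "card K \<le> 1" using card by auto
    moreover have "k \<in> K" "finite K" using k finS by (auto simp: K_def)
    ultimately have K: "K = {k}"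
      by (metis card_le_Suc0_iff_eq One_nat_def empty_iff insert_iff subsetI subset_antisym)
    then have "k = p \<or> k = q" using covers cover k by simp
    moreover have "x \<in> ?M k" using K x unfolding K_def bullied_without_def by blast
    ultimately show ?thesis by blast
  qed
  have up: "{x \<in> I - T. unbullied S (insert x T)} = ?N p \<union> ?N q"
    using up_pq M_T unfolding bullied_without_def by blast
  have down: "{i \<in> S. unbullied (S - {i}) T} = {i \<in> {p, q}. unbullied (S - {i}) T}"
  proof -
    have "i = p \<or> i = q" if "i \<in> S" "unbullied (S - {i}) T" for i
      using unbullied_imp_best_image[OF _ T that(2)] S cover[OF that(1)] by (auto simp: b_def)
    then show ?thesis using pq by blast
  qed
  have fin: "finite (?N k)" for k
    using finite_I by (auto simp: bullied_without_def)
  have "card {x \<in> I - T. unbullied S (insert x T)} = card (?N p) + card (?N q)"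
    unfolding up using M_disj by (intro card_Un_disjoint fin) auto
  moreover have "card {i \<in> S. unbullied (S - {i}) T}
      = (if unbullied (S - {p}) T then 1 else 0) + (if unbullied (S - {q}) T then 1 else 0)"
  proof -
    have "{i \<in> {p, q}. unbullied (S - {i}) T}
        = (if unbullied (S - {p}) T then {p} else {}) \<union> (if unbullied (S - {q}) T then {q} else {})"
      by auto
    then show ?thesis unfolding down using pq(3) by simp
  qed
  ultimately show ?thesis
    using one_room_per_agent[OF S T(1) pq(1) ST M_T] one_room_per_agent[OF S T(1) pq(2) ST M_T]
    by simp
qed

section \<open>Counting doors and rooms\<close>

text \<open>
  The sum of the degrees is even because every edge joins some \<open>A\<close> to \<open>insert i A\<close> and is counted
  once from below and once from above. The two terms of \<open>door_between_two_rooms\<close> are these two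
  directions, except that \<open>i = j\<close> would give a diagonal room.
\<close>

lemma ex_unbullied_diagonal:
  assumes "I \<noteq> {}"
  shows "\<exists>Y\<subseteq>I. Y \<noteq> {} \<and> unbullied Y Y"
proof (rule ccontr)
  assume contra: "\<not> ?thesis"
  have no_diag: "\<not> unbullied Y Y" if "Y \<subseteq> I" for Y
  proof (cases "Y = {}")
    case True
    then show ?thesis using assms by (auto simp: unbullied_def)
  qed (use contra that in blast)
  obtain j where j: "j \<in> I" using assms by blast
  define V where "V = {A. A \<subseteq> I \<and> j \<in> A \<and> unbullied A (A - {j})}"
  define up where "up A = {i \<in> I - A. unbullied A (insert i (A - {j}))}" for A
  define down where "down A = {i \<in> A - {j}. unbullied (A - {i}) (A - {j})}" for A
  have finV: "finite V"
    by (rule finite_subset[of _ "Pow I"]) (auto simp: V_def finite_I)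
  have fin_up: "finite (up A)" and fin_down: "A \<in> V \<Longrightarrow> finite (down A)" for A
    using finite_I finite_subset[of A I] by (auto simp: up_def down_def V_def)
  have jV: "{j} \<in> V" using j by (auto simp: V_def unbullied_def)

  have degree: "card (up A) + card (down A) = (if A = {j} then 1 else 2)" if A: "A \<in> V" for A
  proof -
    let ?T = "A - {j}"
    have AI: "A \<subseteq> I" and jA: "j \<in> A" and ub: "unbullied A ?T" using A by (auto simp: V_def)
    have "insert j ?T = A" using jA by blast
    then have up: "{x \<in> I - ?T. unbullied A (insert x ?T)} = up A"
      using no_diag[OF AI] by (auto simp: up_def)
    have down: "{i \<in> A. unbullied (A - {i}) ?T} = down A"
      using no_diag[of ?T] AI by (auto simp: down_def)
    show ?thesis
    proof (cases "A = {j}")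
      case True
      \<comment> \<open>The boundary door: without other agents, all of \<open>I\<close> is bullied once \<open>j\<close> leaves.\<close>
      have "bullied_without {j} {} j = I" by (auto simp: bullied_without_def)
      moreover have "\<not> unbullied {} {}" using assms by (auto simp: unbullied_def)
      ultimately have "card {x \<in> I. unbullied {j} {x}} = 1"
        using one_room_per_agent[of "{j}" "{}" j] j ub True by auto
      moreover have "down A = {}" using True by (auto simp: down_def)
      ultimately show ?thesis using up True by simp
    next
      case False
      have "finite A" using AI finite_I by (rule finite_subset)
      then have "card A = Suc (card ?T)" using jA by (rule card.remove[of A j, THEN trans]) simp
      then show ?thesis
        using door_between_two_rooms[of A ?T] AI ub False jA up down by auto
    qed
  qed

  have "bij_betw (\<lambda>(A, i). (insert i A, i)) (Sigma V up) (Sigma V down)"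
  proof (rule bij_betw_byWitness[where f' = "\<lambda>(A, i). (A - {i}, i)"])
    show "(\<lambda>(A, i). (insert i A, i)) ` Sigma V up \<subseteq> Sigma V down"
    proof clarify
      fix A i assume A: "A \<in> V" and i: "i \<in> up A"
      have eq: "insert i A - {j} = insert i (A - {j})" "insert i A - {i} = A" and "i \<noteq> j"
        using A i by (auto simp: V_def up_def)
      moreover have "unbullied (insert i A) (insert i (A - {j}))"
        using i by (auto simp: up_def intro: unbullied_mono)
      ultimately show "insert i A \<in> V \<and> i \<in> down (insert i A)"
        using A i by (simp add: V_def up_def down_def)
    qed
    show "(\<lambda>(A, i). (A - {i}, i)) ` Sigma V down \<subseteq> Sigma V up"
    proof clarify
      fix A i assume A: "A \<in> V" and i: "i \<in> down A"
      have eq: "insert i (A - {i} - {j}) = A - {j}"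
        using i by (auto simp: down_def)
      have "unbullied (A - {i}) (A - {i} - {j})"
        using i by (auto simp: down_def intro: unbullied_mono)
      then show "A - {i} \<in> V \<and> i \<in> up (A - {i})"
        using A i eq by (auto simp: V_def up_def down_def)
    qed
  qed (auto simp: up_def down_def)
  then have "card (Sigma V up) = card (Sigma V down)"
    by (rule bij_betw_same_card)
  then have "(\<Sum>A\<in>V. card (up A)) = (\<Sum>A\<in>V. card (down A))"
    using finV fin_up fin_down by (simp add: card_SigmaI)
  then have "(\<Sum>A\<in>V. card (up A) + card (down A)) = 2 * (\<Sum>A\<in>V. card (up A))"
    by (simp add: sum.distrib)
  moreover have "(\<Sum>A\<in>V. card (up A) + card (down A)) = (\<Sum>A\<in>V. if A = {j} then 1 else 2)"
    using degree by (intro sum.cong) auto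
  moreover have "\<dots> = 1 + (\<Sum>A\<in>V - {{j}}. 2)"
    using finV jV by (subst sum.remove[of _ "{j}"]) (auto intro: sum.cong)
  ultimately have "2 * (\<Sum>A\<in>V. card (up A)) = 1 + 2 * card (V - {{j}})" by simp
  then show False by presburger
qed

end

theorem lemma2p1:
  fixes I :: "'a set" and pref :: "'a \<Rightarrow> 'a \<Rightarrow> 'a \<Rightarrow> bool"
  assumes "finite I" and "I \<noteq> {}"
    and "\<And>i. i \<in> I \<Longrightarrow> strict_preference_on I (pref i)"
  shows "\<exists>Y. Y \<subseteq> I \<and> Y \<noteq> {} \<and>
    {best (pref i) Y | i. i \<in> Y} = Y \<and>
    \<not> (\<exists>x \<in> I. \<forall>i \<in> Y. pref i (best (pref i) Y) x)"
proof -
  interpret preference_profile I pref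
    using assms by unfold_locales
  obtain Y where Y: "Y \<subseteq> I" "Y \<noteq> {}" "unbullied Y Y"
    using ex_unbullied_diagonal[OF assms(2)] by blast
  have "{best (pref i) Y | i. i \<in> Y} = Y"
    using unbullied_imp_best_image[OF Y(1) Y] by (simp add: Setcompr_eq_image)
  moreover have "\<not> (\<exists>x \<in> I. \<forall>i \<in> Y. pref i (best (pref i) Y) x)"
    using Y best_mem_and_beats(1) unfolding unbullied_def by blast
  ultimately show ?thesis using Y(1,2) by (intro exI[of _ Y] conjI)
qed

end
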